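(* If $G$ is a connected graph on at most $9$ vertices, then $c(G)\leq 2$.
   Context: Game of cops and robbers on a connected graph $G$: first $k$ cops are placed on vertices (several cops may share a vertex), then the robber is placed on a vertex; then cops and robber alternate moves, the cops moving first. On the cops' turn each cop moves to a neighboring vertex or stays put; on the robber's turn he does likewise. All positions are always known to all players. The cops win if at some finite time a cop occupies the same vertex as the robber. The cop number $c(G)$ is the minimum $k$ such that $k$ cops have a strategy that wins against every robber strategy. *)

theory Defs
  imports "Graph_Theory.Digraph_Component"
begin

definition token_move :: "('a, 'b) pre_digraph \<Rightarrow> 'a \<Rightarrow> 'a \<Rightarrow> bool" where
  "token_move G u v \<longleftrightarrow> u \<in> verts G \<and> v \<in> verts G \<and> (u = v \<or> u \<rightarrow>\<^bsub>G\<^esub> v)"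

definition cop_placements :: "('a, 'b) pre_digraph \<Rightarrow> nat \<Rightarrow> 'a list set" where
  "cop_placements G k = {cs. length cs = k \<and> set cs \<subseteq> verts G}"

text \<open>
  A round consists of an action of the cops followed by an action of the robber. The first round
  is the initial placement, every later one is a pair of moves. A history lists the
  positions (cops, robber) at the end of the completed rounds, oldest first.
\<close>

type_synonym 'a history = "('a list \<times> 'a) list"

definition histories :: "('a, 'b) pre_digraph \<Rightarrow> nat \<Rightarrow> 'a history set" where
  "histories G k = lists (cop_placements G k \<times> verts G)"

text \<open>
  The robber's strategy sees, besides the history, the positions just taken by the cops in the
  current round. On the empty history both kinds of strategy give the initial placement.
\<close>

type_synonym 'a cop_strategy = "'a history \<Rightarrow> 'a list"
type_synonym 'a robber_strategy = "'a history \<Rightarrow> 'a list \<Rightarrow> 'a"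

definition legal_cop_strategy ::
    "('a, 'b) pre_digraph \<Rightarrow> nat \<Rightarrow> 'a cop_strategy \<Rightarrow> bool" where
  "legal_cop_strategy G k \<sigma> \<longleftrightarrow>
     \<sigma> [] \<in> cop_placements G k \<and>
     (\<forall>h \<in> histories G k. h \<noteq> [] \<longrightarrow> list_all2 (token_move G) (fst (last h)) (\<sigma> h))"

definition legal_robber_strategy ::
    "('a, 'b) pre_digraph \<Rightarrow> nat \<Rightarrow> 'a robber_strategy \<Rightarrow> bool" where
  "legal_robber_strategy G k \<rho> \<longleftrightarrow>
     (\<forall>cs \<in> cop_placements G k. \<rho> [] cs \<in> verts G) \<and>
     (\<forall>h \<in> histories G k. \<forall>cs \<in> cop_placements G k.
        h \<noteq> [] \<longrightarrow> token_move G (snd (last h)) (\<rho> h cs))"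

primrec play :: "'a cop_strategy \<Rightarrow> 'a robber_strategy \<Rightarrow> nat \<Rightarrow> 'a history" where
  "play \<sigma> \<rho> 0 = []"
| "play \<sigma> \<rho> (Suc n) = (let h = play \<sigma> \<rho> n; cs = \<sigma> h in h @ [(cs, \<rho> h cs)])"

text \<open>
  The robber can be caught in the middle of a round, when the cops have moved and he has not
  yet moved, or at the end of a round.
\<close>

definition captures :: "'a cop_strategy \<Rightarrow> 'a robber_strategy \<Rightarrow> bool" where
  "captures \<sigma> \<rho> \<longleftrightarrow>
     (\<exists>n. let h = play \<sigma> \<rho> n; cs = \<sigma> h in
        (h \<noteq> [] \<and> snd (last h) \<in> set cs) \<or> \<rho> h cs \<in> set cs)"

definition cops_win :: "('a, 'b) pre_digraph \<Rightarrow> nat \<Rightarrow> bool" where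
  "cops_win G k \<longleftrightarrow>
     (\<exists>\<sigma>. legal_cop_strategy G k \<sigma> \<and> (\<forall>\<rho>. legal_robber_strategy G k \<rho> \<longrightarrow> captures \<sigma> \<rho>))"

definition cop_number :: "('a, 'b) pre_digraph \<Rightarrow> nat" where
  "cop_number G = (LEAST k. cops_win G k)"

text \<open>On a finite graph the minimum defining the cop number is attained.\<close>

lemma cops_win_card_verts:
  assumes "finite (verts G)"
  shows "cops_win G (card (verts G))"
proof -
  obtain xs where xs: "set xs = verts G" "length xs = card (verts G)"
    using assms by (metis distinct_card finite_distinct_list)
  define \<sigma> where "\<sigma> h = (if h = [] then xs else fst (last h))" for h :: "'a history"
  have "list_all2 (token_move G) (fst (last h)) (\<sigma> h)"
    if "h \<in> histories G (card (verts G))" "h \<noteq> []" for h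
  proof -
    have "last h \<in> cop_placements G (card (verts G)) \<times> verts G"
      using that last_in_set[of h] by (auto simp: histories_def)
    then show ?thesis
      using that by (auto simp: \<sigma>_def cop_placements_def token_move_def list_all2_conv_all_nth)
  qed
  then have "legal_cop_strategy G (card (verts G)) \<sigma>"
    using xs by (simp add: legal_cop_strategy_def cop_placements_def \<sigma>_def)
  moreover have "captures \<sigma> \<rho>" if "legal_robber_strategy G (card (verts G)) \<rho>" for \<rho>
    unfolding captures_def using that xs
    by (intro exI[of _ 0]) (simp add: \<sigma>_def legal_robber_strategy_def cop_placements_def)
  ultimately show ?thesis
    unfolding cops_win_def by blast
qed

lemma cops_win_cop_number: "finite (verts G) \<Longrightarrow> cops_win G (cop_number G)"
  unfolding cop_number_def by (rule LeastI) (rule cops_win_card_verts)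

lemma not_cops_win_0:
  assumes "verts G \<noteq> {}"
  shows "\<not> cops_win G 0"
proof
  assume "cops_win G 0"
  then obtain \<sigma> where \<sigma>: "legal_cop_strategy G 0 \<sigma>"
      "\<And>\<rho>. legal_robber_strategy G 0 \<rho> \<Longrightarrow> captures \<sigma> \<rho>"
    unfolding cops_win_def by blast
  obtain v where v: "v \<in> verts G"
    using assms by blast
  define \<rho> where "\<rho> h cs = (if h = [] then v else snd (last h))"
    for h :: "'a history" and cs :: "'a list"
  have last_h: "last h \<in> cop_placements G 0 \<times> verts G" if "h \<in> histories G 0" "h \<noteq> []" for h
    using that last_in_set[of h] by (auto simp: histories_def)
  then have \<rho>_verts: "\<rho> h cs \<in> verts G" if "h \<in> histories G 0" for h cs
    using v that by (auto simp: \<rho>_def mem_Times_iff)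
  have \<rho>: "legal_robber_strategy G 0 \<rho>"
    using v last_h by (force simp: legal_robber_strategy_def \<rho>_def token_move_def)
  have "play \<sigma> \<rho> n \<in> histories G 0 \<and> \<sigma> (play \<sigma> \<rho> n) = []" for n
  proof (induction n)
    case 0
    then show ?case
      using \<sigma>(1) by (simp add: histories_def legal_cop_strategy_def cop_placements_def)
  next
    case (Suc n)
    have "\<rho> (play \<sigma> \<rho> n) [] \<in> verts G"
      using Suc \<rho>_verts by blast
    then have "play \<sigma> \<rho> (Suc n) \<in> histories G 0"
      using Suc by (simp add: histories_def cop_placements_def Let_def)
    moreover have "list_all2 (token_move G) (fst (last (play \<sigma> \<rho> (Suc n)))) (\<sigma> (play \<sigma> \<rho> (Suc n)))"
      using calculation \<sigma>(1) unfolding legal_cop_strategy_def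
      by (auto simp: Let_def)
    ultimately show ?case
      using Suc by (simp add: Let_def)
  qed
  then have "\<not> captures \<sigma> \<rho>"
    by (simp add: captures_def Let_def)
  with \<sigma>(2)[OF \<rho>] show False by simp
qed

end

theory Submission
  imports Defs
begin

text \<open>
  If the robber can evade two cops, consider the relation \<open>S c d r\<close>: with the cops on
  \<open>c\<close>, \<open>d\<close> and to move, the robber on \<open>r\<close> is never caught. Park one cop on \<open>u\<close>; then the robber
  is confined to the territory \<open>T\<close> of vertices outside the closed neighbourhood of \<open>u\<close>, where he
  must evade the other cop.

  If \<open>T\<close> has at most four vertices, it is a 4-cycle and the robber always sits opposite to the
  second cop. Letting the first cop attack him from a neighbour of \<open>u\<close> shows that every vertex of
  the cycle has two neighbours which are adjacent to \<open>u\<close> and to all of the cycle but the opposite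
  vertex. That makes more than nine vertices. So for at most nine vertices the maximum degree is
  at most two, where two cops easily close in on the robber, or it is three and there are exactly
  nine vertices.

  In the latter case \<open>T\<close> is, for every vertex \<open>u\<close> of degree three, an induced 5-cycle all of whose
  vertices have a neighbour outside, so that every vertex at distance at least two from a vertex
  of degree three has itself degree three. A vertex of smaller degree would thus be adjacent to all
  vertices of degree three, of which there are at least six. Hence the graph is cubic, which is
  impossible on nine vertices.
\<close>

text \<open>The handshake argument: an injection into the naturals orients each pair, so the
  relation is the disjoint union of its increasing pairs and their converses.\<close>

lemma even_card_sym_irrefl:
  fixes R :: "('a \<times> 'a) set"
  assumes "finite R" "sym R" "irrefl R"
  shows "even (card R)"
proof -
  have "finite (Field R)"
    using assms(1) finite_Field by blast
  then obtain f :: "'a \<Rightarrow> nat" where f: "inj_on f (Field R)"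
    using finite_imp_inj_to_nat_seg by metis
  let ?A = "{(x, y) \<in> R. f x < f y}"
  have "R = ?A \<union> ?A\<inverse>"
  proof (intro equalityI subrelI)
    fix x y assume xy: "(x, y) \<in> R"
    then have "x \<noteq> y" "x \<in> Field R" "y \<in> Field R" "(y, x) \<in> R"
      using assms by (auto simp: irrefl_def Field_def dest: symD)
    moreover from this have "f x \<noteq> f y"
      using f by (metis inj_onD)
    ultimately show "(x, y) \<in> ?A \<union> ?A\<inverse>"
      using xy by auto
  qed (use assms(2) in \<open>auto dest: symD\<close>)
  moreover have "card (?A \<union> ?A\<inverse>) = card ?A + card (?A\<inverse>)"
    using assms(1) by (intro card_Un_disjoint) (auto intro: finite_subset)
  ultimately have "card R = 2 * card ?A"
    by simp
  then show ?thesis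
    by simp
qed

section \<open>Evading two cops\<close>

text \<open>\<open>N x\<close> is the closed neighbourhood of \<open>x\<close>, so a vertex of degree \<open>k\<close> has \<open>card (N x) = k + 1\<close>.\<close>

locale evasion =
  fixes V :: "'a set" and N :: "'a \<Rightarrow> 'a set" and S :: "'a \<Rightarrow> 'a \<Rightarrow> 'a \<Rightarrow> bool"
  assumes finite_V: "finite V"
    and V_nonempty: "V \<noteq> {}"
    and N_subset: "N x \<subseteq> V"
    and N_refl: "x \<in> V \<Longrightarrow> x \<in> N x"
    and N_sym: "y \<in> N x \<Longrightarrow> x \<in> N y"
    and connected: "\<lbrakk>x \<in> X; x \<in> V; y \<in> V; \<And>z. z \<in> X \<Longrightarrow> N z \<subseteq> X\<rbrakk> \<Longrightarrow> y \<in> X"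
    and S_in_V: "S c d r \<Longrightarrow> c \<in> V \<and> d \<in> V \<and> r \<in> V"
    and S_sym: "S c d r \<Longrightarrow> S d c r"
    and S_safe: "S c d r \<Longrightarrow> r \<notin> N c"
    and S_step: "\<lbrakk>S c d r; c' \<in> N c; d' \<in> N d\<rbrakk> \<Longrightarrow> \<exists>r'\<in>N r. S c' d' r'"
    and S_start: "\<lbrakk>c \<in> V; d \<in> V\<rbrakk> \<Longrightarrow> \<exists>r. S c d r"
begin

lemma N_in_V: "y \<in> N x \<Longrightarrow> y \<in> V"
  using N_subset by blast

lemma finite_N: "finite (N x)"
  using N_subset finite_V finite_subset by blast

lemma escape:
  assumes "S c d r" "c' \<in> N c" "d' \<in> N d"
  obtains r' where "r' \<in> N r" "S c' d' r'" "r' \<notin> N c'" "r' \<notin> N d'" "r' \<in> V"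
  using S_step[OF assms] S_safe S_sym N_in_V by blast

text \<open>The second cop can walk to \<open>x\<close> while the first one keeps the robber in \<open>K\<close>.\<close>

lemma confined:
  assumes "S u c r" "r \<in> K" "\<And>k. k \<in> K \<Longrightarrow> N k \<subseteq> K \<union> N u" "x \<in> V" "K \<subseteq> N x"
  shows False
proof -
  \<comment> \<open>The positions of the second cop against which the robber survives in
    \<open>K\<close> are closed under moves, as each answer must avoid \<open>N u\<close>. By
    connectivity they include \<open>x\<close>, which attacks all of \<open>K\<close>.\<close>
  have "x \<in> {d. \<exists>r'\<in>K. S u d r'}"
  proof (rule connected[of c])
    show "c \<in> {d. \<exists>r'\<in>K. S u d r'}" "c \<in> V" "x \<in> V"
      using assms S_in_V by blast+
    fix d assume "d \<in> {d. \<exists>r'\<in>K. S u d r'}"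
    then obtain r' where r': "r' \<in> K" "S u d r'" by blast
    show "N d \<subseteq> {d. \<exists>r'\<in>K. S u d r'}"
    proof
      fix d' assume "d' \<in> N d"
      moreover have "u \<in> N u"
        using r' S_in_V N_refl by blast
      ultimately obtain q where "q \<in> N r'" "S u d' q" "q \<notin> N u"
        using r' escape by metis
      then show "d' \<in> {d. \<exists>r'\<in>K. S u d r'}"
        using assms(3)[OF r'(1)] by blast
    qed
  qed
  then show False
    using assms(5) S_safe S_sym by blast
qed

text \<open>Otherwise the cop on \<open>u\<close> pins the robber to the single vertex
  \<open>r\<close>, and the other cop walks up to him.\<close>

lemma not_stuck:
  assumes "S u c r" "N r \<subseteq> insert r (N u)"
  shows False
  using confined[OF assms(1), of "{r}" r] assms S_in_V N_refl by auto

text \<open>The first cop attacks by moving from \<open>u\<close> to the only free neighbour of the robber.\<close>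

lemma one_free_neighbour:
  assumes "S u c r" "N r \<subseteq> insert r (insert a (N c))" "a \<in> N u"
  shows False
proof (cases "a \<in> N r")
  case True
  have "c \<in> N c" "a \<in> N a" "r \<in> N a"
    using assms True S_in_V N_refl N_in_V N_sym by blast+
  then show False
    using escape[OF assms(1,3), of c] assms(2) by blast
next
  case False
  then show False
    using not_stuck[OF S_sym[OF assms(1)]] assms(2) by blast
qed

text \<open>The bound makes the territory a graph of maximum degree one. The robber is locked in the
  vertex or edge \<open>N r - N u\<close>, all of which is attacked from \<open>r\<close>.\<close>

lemma territory_matching:
  assumes "u \<in> V" "\<And>c. c \<in> V - N u \<Longrightarrow> card (N c - N u) \<le> 2"
  shows False
proof -
  obtain r where r: "S u u r"
    using S_start assms(1) by blast
  then have rT: "r \<in> V" "r \<notin> N u"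
    using S_in_V S_safe by blast+
  show False
  proof (rule confined[OF r, of "N r - N u" r])
    show "r \<in> N r - N u" "r \<in> V" "N r - N u \<subseteq> N r"
      using rT N_refl by auto
    fix k assume k: "k \<in> N r - N u"
    have "N k - N u \<subseteq> N r - N u"
    proof (cases "k = r")
      case False
      have *: "{r, k} \<subseteq> N r - N u" "{r, k} \<subseteq> N k - N u"
        using k rT N_refl N_sym N_in_V by auto
      have "k \<in> V"
        using k N_in_V by blast
      then have "card (N r - N u) \<le> card {r, k}" "card (N k - N u) \<le> card {r, k}"
        using assms(2)[of r] assms(2)[of k] rT k False by auto
      then have "{r, k} = N r - N u" "{r, k} = N k - N u"
        using * finite_N by (metis card_seteq finite_Diff)+
      then show ?thesis by blast
    qed simp
    then show "N k \<subseteq> N r - N u \<union> N u"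
      by blast
  qed
qed

text \<open>The robber must start on \<open>r\<close>. As he is not stuck there, he has a free
  neighbour \<open>y\<close>, necessarily in \<open>N c\<close>; when the second cop steps to
  \<open>y\<close> he needs another refuge \<open>z\<close>. So \<open>c\<close>, \<open>y\<close>,
  \<open>r\<close>, \<open>z\<close> form an induced 4-cycle.\<close>

lemma one_undominated:
  assumes "u \<in> V" "c \<in> V" "V - N u - N c = {r}"
  obtains y z where "S u c r" "y \<in> N c \<inter> N r - N u" "z \<in> N c \<inter> N r - N u" "z \<notin> N y"
proof -
  obtain r' where "S u c r'"
    using S_start assms by blast
  moreover from this have "r' \<in> V - N u - N c"
    using S_safe S_sym S_in_V by blast
  ultimately have S: "S u c r"
    using assms(3) by simp
  from not_stuck[OF S] obtain y where y: "y \<in> N r" "y \<notin> N u" "y \<noteq> r"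
    by blast
  then have yc: "y \<in> N c"
    using assms(3) N_in_V by blast
  moreover have "u \<in> N u"
    using assms N_refl by blast
  ultimately obtain z where z: "z \<in> N r" "z \<notin> N u" "z \<notin> N y" "z \<in> V"
    using escape[OF S] by metis
  moreover have "z \<noteq> r"
    using y z N_sym by blast
  ultimately have "z \<in> N c"
    using assms(3) by blast
  then show thesis
    using that S y z yc by blast
qed

section \<open>Territories with at most four vertices\<close>

text \<open>With cops on \<open>u\<close> and \<open>r\<close> the robber must be on the opposite
  vertex \<open>p\<close>. The required vertices are his refuges when the first cop attacks from
  common neighbours of \<open>u\<close> and \<open>p\<close>.\<close>

lemma four_cycle_neighbours:
  assumes "u \<in> V" "V - N u = {p, q, r, s}"
    and "q \<in> N p" "r \<in> N q" "s \<in> N r" "p \<in> N s" "r \<notin> N p" "s \<notin> N q"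
  shows "\<exists>b b'. b \<noteq> b' \<and> {b, b'} \<subseteq> N u \<and> r \<notin> N b \<union> N b' \<and> {p, q, s} \<subseteq> N b \<inter> N b'"
proof -
  have V: "p \<in> V" "q \<in> V" "r \<in> V" "s \<in> V" and u: "p \<notin> N u" "q \<notin> N u" "r \<notin> N u" "s \<notin> N u"
    using assms(2) by blast+
  have adj: "p \<in> N q" "q \<in> N r" "r \<in> N s" "s \<in> N p" "p \<notin> N r" "q \<notin> N s"
    using assms N_sym by blast+
  obtain r' where r': "S u r r'"
    using S_start assms V by blast
  then have "r' \<in> V - N u - N r"
    using S_safe S_sym S_in_V by blast
  then have "r' = p"
    using assms(2,5) adj N_refl[OF V(3)] by blast
  then have S: "S u r p"
    using r' by simp
  have refl: "u \<in> N u" "r \<in> N r" "q \<in> N q" "s \<in> N s"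
    using assms(1) V N_refl by blast+
  \<comment> \<open>The refuge \<open>b\<close> lies off the cycle. The first cop now returns from
    \<open>a\<close> to \<open>u\<close> while the second steps to \<open>q\<close> or to
    \<open>s\<close>; the only safe vertex is then \<open>s\<close> or \<open>q\<close>
    respectively, so \<open>b\<close> is adjacent to both.\<close>
  have next_b: "\<exists>b. b \<in> N p \<inter> N u \<and> b \<notin> N a \<and> q \<in> N b \<and> s \<in> N b \<and> r \<notin> N b" if a: "a \<in> N p \<inter> N u" for a
  proof -
    obtain b where b: "b \<in> N p" "S a r b" "b \<notin> N a" "b \<notin> N r" "b \<in> V"
      using escape[OF S, of a r] a refl by blast
    have "b \<noteq> p" "b \<noteq> q" "b \<noteq> r" "b \<noteq> s"
      using b a N_sym adj assms refl by blast+
    then have bu: "b \<in> N u"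
      using b(5) assms(2) by blast
    have ua: "u \<in> N a"
      using a N_sym by blast
    obtain x where x: "x \<in> N b" "x \<notin> N u" "x \<notin> N q" "x \<in> V"
      by (rule escape[OF b(2) ua adj(2)])
    then have "x \<in> {p, q, r, s}"
      unfolding assms(2)[symmetric] by simp
    then have sb: "s \<in> N b"
      using x assms(4) refl adj by auto
    obtain x where x: "x \<in> N b" "x \<notin> N u" "x \<notin> N s" "x \<in> V"
      by (rule escape[OF b(2) ua assms(5)])
    then have "x \<in> {p, q, r, s}"
      unfolding assms(2)[symmetric] by simp
    then have "q \<in> N b"
      using x assms(6) refl adj by auto
    then show ?thesis
      using sb b bu N_sym[of r b] by blast
  qed
  have "N p \<inter> N u \<noteq> {}"
  proof
    assume "N p \<inter> N u = {}"
    then have "N p \<subseteq> {p, q, r, s}"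
      using assms(2) N_in_V by blast
    then have "N p \<subseteq> insert p (N r)"
      using assms(5,7) adj by blast
    then show False
      using not_stuck[OF S_sym[OF S]] by blast
  qed
  then obtain b where b: "b \<in> N p \<inter> N u" "q \<in> N b" "s \<in> N b" "r \<notin> N b"
    using next_b by blast
  \<comment> \<open>Attacking from \<open>b\<close> itself gives a refuge not adjacent to
    \<open>b\<close>, hence a second vertex.\<close>
  obtain b' where b': "b' \<in> N p \<inter> N u" "b' \<notin> N b" "q \<in> N b'" "s \<in> N b'" "r \<notin> N b'"
    using next_b[OF b(1)] by blast
  have "b \<noteq> b'"
    using b' N_refl N_in_V by blast
  moreover have "p \<in> N b" "p \<in> N b'"
    using b(1) b'(1) N_sym by blast+
  ultimately show ?thesis
    using b b' by (intro exI[of _ b] exI[of _ b']) simp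
qed

text \<open>The pairs for different opposite vertices are disjoint, because each misses its own
  opposite vertex and sees the other three. Three pairs and \<open>u\<close> put seven vertices into
  \<open>N u\<close>, besides four in the territory.\<close>

lemma no_four_cycle_territory:
  assumes "u \<in> V" "V - N u = {p, q, r, s}"
    and "q \<in> N p" "r \<in> N q" "s \<in> N r" "p \<in> N s" "r \<notin> N p" "s \<notin> N q" "card V \<le> 9"
  shows False
proof -
  have adj: "p \<in> N q" "q \<in> N r" "r \<in> N s" "s \<in> N p" "p \<notin> N r" "q \<notin> N s"
    using assms N_sym by blast+
  have V: "p \<in> V" "q \<in> V" "r \<in> V" "s \<in> V" and u: "p \<notin> N u" "q \<notin> N u" "r \<notin> N u" "s \<notin> N u"
    using assms(2) by blast+
  have dist: "distinct [p, q, r, s]"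
    using adj assms N_refl V by auto
  have rot: "V - N u = {q, r, s, p}" "V - N u = {r, s, p, q}"
    using assms(2) by blast+
  obtain a a' where a: "a \<noteq> a'" "a \<in> N u" "a' \<in> N u" "r \<notin> N a" "r \<notin> N a'" "p \<in> N a" "p \<in> N a'"
    "s \<in> N a" "s \<in> N a'"
    using four_cycle_neighbours[OF assms(1-8)] by auto
  obtain b b' where b: "b \<noteq> b'" "b \<in> N u" "b' \<in> N u" "s \<notin> N b" "s \<notin> N b'" "p \<in> N b" "p \<in> N b'"
    "r \<in> N b" "r \<in> N b'"
    using four_cycle_neighbours[OF assms(1) rot(1) assms(4-6) assms(3,8)] adj by auto
  obtain c c' where c: "c \<noteq> c'" "c \<in> N u" "c' \<in> N u" "p \<notin> N c" "p \<notin> N c'"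
    "r \<in> N c" "r \<in> N c'" "s \<in> N c" "s \<in> N c'"
    using four_cycle_neighbours[OF assms(1) rot(2) assms(5,6,3,4)] adj by auto
  have "u \<in> N u"
    using assms N_refl by blast
  then have "distinct [u, a, a', b, b', c, c']" and sub: "set [u, a, a', b, b', c, c'] \<subseteq> N u"
    using a b c u by auto
  then have "card (set [u, a, a', b, b', c, c']) = 7"
    by (subst distinct_card) simp_all
  then have "7 \<le> card (N u)"
    using sub finite_N card_mono by metis
  moreover have "card (V - N u) = 4"
    using dist unfolding assms(2) by simp
  ultimately show False
    using assms(9) card_Diff_subset[OF finite_N N_subset, of u] by linarith
qed

text \<open>If some \<open>c\<close> in the territory leaves just one vertex unguarded, the induced
  4-cycle fills the territory. Otherwise each \<open>c\<close> leaves at least two, so the territory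
  is a matching.\<close>

lemma small_territory:
  assumes "u \<in> V" "card (V - N u) \<le> 4" "card V \<le> 9"
  shows False
proof (cases "\<exists>c\<in>V - N u. \<exists>r. V - N u - N c = {r}")
  case True
  then obtain c r where c: "c \<in> V" "c \<notin> N u" and r: "V - N u - N c = {r}"
    by blast
  then obtain y z where yz: "S u c r" "y \<in> N c" "y \<in> N r" "y \<notin> N u" "z \<in> N c" "z \<in> N r" "z \<notin> N u"
      "z \<notin> N y"
    using one_undominated[OF assms(1)] by blast
  have rT: "r \<in> V" "r \<notin> N u" "r \<notin> N c"
    using r by blast+
  have sub: "{c, y, r, z} \<subseteq> V - N u"
    using c rT yz N_in_V by blast
  have "y \<noteq> z" "c \<noteq> r" "y \<noteq> c" "y \<noteq> r" "z \<noteq> c" "z \<noteq> r"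
    using yz rT c N_refl N_in_V N_sym by blast+
  then have "card {c, y, r, z} = 4"
    by simp
  then have "V - N u = {c, y, r, z}"
    using card_seteq[OF _ sub] assms(2) finite_V by simp
  then show False
    using no_four_cycle_territory[OF assms(1), of c y r z] yz rT N_sym assms(3) by blast
next
  case False
  show False
  proof (rule territory_matching[OF assms(1)])
    fix c assume c: "c \<in> V - N u"
    obtain r where "S u c r"
      using S_start assms c by blast
    then have "r \<in> V - N u - N c"
      using S_safe S_sym S_in_V by blast
    then have "card (V - N u - N c) \<noteq> 0" "card (V - N u - N c) \<noteq> 1"
      using False c finite_V by (auto simp: card_1_singleton_iff)
    then have "card (V - N u - N c) \<ge> 2"
      by linarith
    moreover have "card (V - N u) = card (V - N u - N c) + card (N c - N u)"
    proof -
      have "V - N u = (V - N u - N c) \<union> (N c - N u)"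
        using N_in_V by blast
      then show ?thesis
        using card_Un_disjoint[of "V - N u - N c" "N c - N u"] finite_V finite_N by auto
    qed
    ultimately show "card (N c - N u) \<le> 2"
      using assms(2) by linarith
  qed
qed

section \<open>Maximum degree two\<close>

text \<open>
  The robber is confined to a set \<open>K\<close> whose boundary is occupied by the cops. Unless both cops are
  together, each has at most one neighbour in \<open>K\<close>, so that advancing there keeps the robber confined.
\<close>

lemma no_evasion_between:
  assumes deg: "\<And>v. v \<in> V \<Longrightarrow> card (N v) \<le> 3"
    and "S c d r" "r \<in> K" "K \<subseteq> V" "c \<notin> K" "d \<notin> K" "\<And>k. k \<in> K \<Longrightarrow> N k \<subseteq> K \<union> {c, d}"
    and "c = d \<or> card (N c \<inter> K) \<le> 1 \<and> card (N d \<inter> K) \<le> 1"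
  shows False
  using assms(2-)
proof (induction "card K" arbitrary: K c d r rule: less_induct)
  case less
  have advance: False
    if e: "S e d r'" "r' \<in> K" "e \<notin> K" "k1 \<in> N e" "k1 \<in> K" "\<And>k. k \<in> K \<Longrightarrow> N k \<subseteq> K \<union> {e, d}"
      and or: "e = d \<or> card (N e \<inter> K) \<le> 1 \<and> card (N d \<inter> K) \<le> 1" for e r' k1
  proof -
    let ?K = "K - {k1}"
    have V: "e \<in> V" "d \<in> V" "k1 \<in> V"
      using e S_in_V N_in_V by blast+
    then obtain r1 where r1: "r1 \<in> N r'" "S k1 d r1" "r1 \<notin> N k1" "r1 \<notin> N d" "r1 \<in> V"
      using escape[OF e(1,4)] N_refl by blast
    have "e \<in> N k1" "k1 \<in> N k1" "d \<in> N d" "e \<in> N e"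
      using e V N_sym N_refl by blast+
    then have r1K: "r1 \<in> ?K"
      using e(6)[OF e(2)] r1 by blast
    have two_less: "card (A - {a, b}) \<le> 1" if "card A \<le> 3" "a \<in> A" "b \<in> A" "a \<noteq> b"
      for A and a b :: 'a
      using that by (simp add: card_Diff_subset)
    show False
    proof (rule less.hyps[of ?K k1 d r1])
      show "card ?K < card K"
        using e less.prems(3) finite_V finite_subset by (metis card_Diff1_less)
      show "S k1 d r1" "r1 \<in> ?K" "?K \<subseteq> V" "k1 \<notin> ?K" "d \<notin> ?K"
        using r1 r1K less.prems by auto
      fix k assume k: "k \<in> ?K"
      \<comment> \<open>A second neighbour of \<open>e\<close> in \<open>K\<close> would violate
        \<open>or\<close>, so abandoning \<open>e\<close> opens no exit.\<close>
      have "e \<notin> N k" if "e \<noteq> d"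
      proof
        assume "e \<in> N k"
        then have "{k, k1} \<subseteq> N e \<inter> K"
          using k e N_sym by blast
        then have "card {k, k1} \<le> card (N e \<inter> K)"
          using finite_N by (meson card_mono finite_Int)
        then show False
          using or that k by auto
      qed
      then show "N k \<subseteq> ?K \<union> {k1, d}"
        using e(6)[of k] k by blast
    next
      have "card (N k1 \<inter> ?K) \<le> card (N k1 - {k1, e})"
        using e finite_N by (intro card_mono) auto
      also have "\<dots> \<le> 1"
        using \<open>e \<in> N k1\<close> \<open>k1 \<in> N k1\<close> deg V e by (intro two_less) auto
      finally have "card (N k1 \<inter> ?K) \<le> 1" .
      moreover have "card (N d \<inter> ?K) \<le> 1"
      proof (cases "e = d")
        case True
        have "card (N e \<inter> ?K) \<le> card (N e - {k1, e})"
          using e finite_N by (intro card_mono) auto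
        also have "\<dots> \<le> 1"
          using \<open>e \<in> N e\<close> e deg V by (intro two_less) auto
        finally show ?thesis
          using True by simp
      next
        case False
        have "card (N d \<inter> ?K) \<le> card (N d \<inter> K)"
          using finite_N by (intro card_mono) auto
        then show ?thesis
          using or False by simp
      qed
      ultimately show "k1 = d \<or> card (N k1 \<inter> ?K) \<le> 1 \<and> card (N d \<inter> ?K) \<le> 1"
        by simp
    qed
  qed
  \<comment> \<open>With both cops on \<open>d\<close>, one keeps guarding \<open>d\<close> while
    the other advances into \<open>K\<close>.\<close>
  have together: False if "S d d r'" "r' \<in> K" "\<And>k. k \<in> K \<Longrightarrow> N k \<subseteq> K \<union> {d}" for r'
  proof (cases "N d \<inter> K = {}")
    case True
    then have "N k \<subseteq> K" if "k \<in> K" for k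
      using \<open>\<And>k. k \<in> K \<Longrightarrow> N k \<subseteq> K \<union> {d}\<close>[OF that] that N_sym by blast
    then have "d \<in> K"
      using connected[of r' K d] that S_in_V by blast
    then show False
      using less.prems by blast
  next
    case False
    then obtain k1 where "k1 \<in> N d" "k1 \<in> K"
      by blast
    then show False
      using advance[OF that(1,2) less.prems(5), of k1] that(3) by simp
  qed
  show False
  proof (cases "N c \<inter> K = {}")
    case False
    then obtain k1 where "k1 \<in> N c" "k1 \<in> K"
      by blast
    then show False
      using advance[OF less.prems(1,2,4) _ _ less.prems(6,7)] by blast
  next
    \<comment> \<open>Here \<open>d\<close> alone guards \<open>K\<close>, so the cop on
      \<open>c\<close> is free to walk to \<open>d\<close>, which leads to
      \<open>together\<close>.\<close>
    case True
    have K: "N k \<subseteq> K \<union> {d}" if "k \<in> K" for k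
      using less.prems(6)[OF that] that True N_sym by blast
    have "d \<in> {e. \<exists>r'\<in>K. S e d r'}"
    proof (rule connected[of c])
      show "c \<in> {e. \<exists>r'\<in>K. S e d r'}" "c \<in> V" and d: "d \<in> V"
        using less.prems S_in_V by blast+
      fix e assume "e \<in> {e. \<exists>r'\<in>K. S e d r'}"
      then obtain r' where r': "r' \<in> K" "S e d r'"
        by blast
      show "N e \<subseteq> {e. \<exists>r'\<in>K. S e d r'}"
      proof
        fix e' assume "e' \<in> N e"
        then obtain q where "q \<in> N r'" "S e' d q" "q \<notin> N d"
          using escape[OF r'(2), of e' d] N_refl d by blast
        moreover have "d \<in> N d"
          using d N_refl by blast
        ultimately show "e' \<in> {e. \<exists>r'\<in>K. S e d r'}"
          using K[OF r'(1)] by blast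
      qed
    qed
    then show False
      using together K by blast
  qed
qed

lemma not_max_degree_two:
  assumes "\<And>v. v \<in> V \<Longrightarrow> card (N v) \<le> 3"
  shows False
proof -
  obtain c where c: "c \<in> V"
    using V_nonempty by blast
  then obtain r where "S c c r"
    using S_start by blast
  moreover from this have "r \<in> V - {c}"
    using S_safe S_in_V N_refl by blast
  ultimately show False
    using no_evasion_between[OF assms, of c c r "V - {c}"] N_in_V by blast
qed

section \<open>Territories with five vertices\<close>

text \<open>Otherwise only one vertex \<open>r\<close> is left unguarded by \<open>u\<close> and
  \<open>c\<close>. Two of its at most three neighbours are in \<open>N c\<close>, and a third,
  \<open>a\<close>, either is also guarded from \<open>c\<close> or lies in \<open>N u\<close>, from
  where the first cop attacks.\<close>

lemma no_vertex_of_degree_three_in_territory: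
  assumes "\<And>v. v \<in> V \<Longrightarrow> card (N v) \<le> 4"
    and "u \<in> V" "card (V - N u) = 5" "c \<in> V - N u"
  shows "card (N c - N u) \<le> 3"
proof (rule ccontr)
  assume "\<not> card (N c - N u) \<le> 3"
  moreover have "card (V - N u) = card (V - N u - N c) + card (N c - N u)"
  proof -
    have "V - N u = (V - N u - N c) \<union> (N c - N u)"
      using N_in_V by blast
    then show ?thesis
      using card_Un_disjoint[of "V - N u - N c" "N c - N u"] finite_V finite_N by auto
  qed
  ultimately have le: "card (V - N u - N c) \<le> 1"
    using assms(3) by linarith
  obtain r where "S u c r"
    using S_start assms by blast
  then have "r \<in> V - N u - N c"
    using S_safe S_sym S_in_V by blast
  then have r: "V - N u - N c = {r}"
    using le finite_V by (auto simp: card_le_Suc0_iff_eq)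
  have "c \<in> V"
    using assms(4) by blast
  then obtain y z where "S u c r" and yz': "y \<in> N c \<inter> N r - N u" "z \<in> N c \<inter> N r - N u" "z \<notin> N y"
    by (rule one_undominated[OF assms(2) _ r])
  then have yz: "S u c r" "y \<in> N c" "y \<in> N r" "z \<in> N c" "z \<in> N r" "z \<notin> N y" "y \<in> V"
    using N_in_V by auto
  have rc: "r \<in> V" "r \<notin> N c"
    using r by blast+
  have dist: "r \<noteq> y" "r \<noteq> z" "y \<noteq> z"
    using yz rc N_refl by auto
  have "{r, y, z} \<subseteq> N r"
    using yz rc N_refl by auto
  then have "card (N r - {r, y, z}) \<le> 1"
    using dist assms(1)[of r] rc by (simp add: card_Diff_subset)
  then consider "N r - {r, y, z} = {}" | a where "N r - {r, y, z} = {a}"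
    using finite_N by (metis card_0_eq card_1_singletonE finite_Diff le_neq_implies_less less_one)
  \<comment> \<open>If \<open>r\<close> has no third neighbour, \<open>r\<close> itself serves as
    the dummy value of \<open>a\<close>.\<close>
  then obtain a where a: "N r \<subseteq> {r, y, z, a}" "a \<in> N r"
  proof cases
    case 1
    then show thesis
      using that[of r] N_refl[OF rc(1)] by auto
  next
    case 2
    then show thesis
      using that by blast
  qed
  show False
  proof (cases "a \<in> insert r (N c)")
    case True
    then have "N r \<subseteq> insert r (N c)"
      using a yz by blast
    then show False
      using not_stuck[OF S_sym[OF yz(1)]] by blast
  next
    case False
    have "a \<in> V"
      using a N_in_V by blast
    then have "a \<in> N u"
      using False r by blast
    then show False
      using one_free_neighbour[OF yz(1), of a] a yz by blast
  qed
qed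

text \<open>Together with \<open>c\<close> the path closes to a 5-cycle. Its edges are forced by
  chasing the robber with the second cop while the first stays on \<open>u\<close>.\<close>

lemma five_territory_path:
  assumes deg: "\<And>v. v \<in> V \<Longrightarrow> card (N v) \<le> 4"
    and u: "u \<in> V" and T: "V - N u = {c, p, q, x, y}" "distinct [c, p, q, x, y]"
    and Nc: "N c - N u = {c, p, q}" and S: "S u c x"
    and deg_T: "\<And>v. v \<in> V - N u \<Longrightarrow> card (N v - N u) \<le> 3"
  shows "x \<in> N p \<and> y \<in> N x \<and> q \<in> N y \<or> x \<in> N q \<and> y \<in> N x \<and> p \<in> N y"
proof -
  have V: "c \<in> V" "p \<in> V" "q \<in> V" "x \<in> V" "y \<in> V"
    and nu: "c \<notin> N u" "p \<notin> N u" "q \<notin> N u" "x \<notin> N u" "y \<notin> N u"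
    using T(1) by blast+
  have refl: "u \<in> N u" "c \<in> N c" "p \<in> N p" "q \<in> N q" "x \<in> N x" "y \<in> N y"
    using u V N_refl by blast+
  have pq: "p \<in> N c" "q \<in> N c"
    using Nc by blast+
  have "x \<notin> N c" "y \<notin> N c"
    using Nc T(2) nu by auto
  then have c: "c \<notin> N x" "c \<notin> N y"
    using N_sym by blast+
  have in_T: "v \<in> {c, p, q, x, y}" if "v \<in> V" "v \<notin> N u" for v
    unfolding T(1)[symmetric] using that by simp
  \<comment> \<open>The chase goes from \<open>c\<close> to \<open>p'\<close>, which drives the
    robber to \<open>y\<close>, and then to \<open>x\<close>, which drives him to
    \<open>q'\<close>.\<close>
  have path: "y \<in> N x \<and> q' \<in> N y"
    if p': "{p', q'} = {p, q}" "x \<in> N p'" "x \<notin> N q'" for p' q'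
  proof -
    have p'c: "p' \<in> N c" and p'p': "p' \<in> N p'" and xp': "p' \<in> N x" "q' \<notin> N x"
      using p' pq refl N_sym by (auto simp: doubleton_eq_iff)
    have in_T': "v \<in> {c, p', q', x, y}" if "v \<in> V" "v \<notin> N u" for v
      using p'(1) in_T[OF that] by (auto simp: doubleton_eq_iff)
    obtain v where v: "v \<in> N x" "S u p' v" "v \<notin> N u" "v \<notin> N p'" "v \<in> V"
      using escape[OF S refl(1) p'c] by blast
    have y: "v = y"
      using in_T'[OF v(5,3)] v c xp' p'(2) p'p' by auto
    obtain w where w: "w \<in> N y" "S u x w" "w \<notin> N u" "w \<notin> N x" "w \<in> V"
      using escape[OF v(2) refl(1) p'(2)] y by blast
    have "w = q'"
      using in_T'[OF w(5,3)] w c xp' v y refl by auto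
    then show ?thesis
      using v w y by blast
  qed
  have "x \<in> N p \<or> x \<in> N q"
  proof (rule ccontr)
    assume "\<not> (x \<in> N p \<or> x \<in> N q)"
    then have px: "p \<notin> N x" "q \<notin> N x" "x \<notin> N p" "x \<notin> N q"
      using N_sym by blast+
    have xT: "v = x \<or> v = y" if "v \<in> N x" "v \<notin> N u" for v
      using in_T[of v] that N_in_V c px by auto
    have "y \<in> N x"
      using not_stuck[OF S] xT by blast
    then have xy: "x \<in> N y"
      using N_sym by blast
    \<comment> \<open>If \<open>p'\<close> saw \<open>y\<close>, the second cop would go there,
      holding the robber on \<open>x\<close>, and then step to \<open>y\<close>, which attacks both
      \<open>x\<close> and \<open>y\<close>.\<close>
    have no: "y \<notin> N p'" if p': "p' \<in> N c" "p' \<notin> N x" for p'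
    proof
      assume y: "y \<in> N p'"
      obtain v where v: "v \<in> N x" "S u p' v" "v \<notin> N u" "v \<notin> N p'"
        using escape[OF S refl(1) p'(1)] by blast
      then have "v = x"
        using xT y by blast
      then obtain w where "w \<in> N x" "w \<notin> N u" "w \<notin> N y"
        using escape[OF v(2) refl(1) y] by blast
      then show False
        using xT xy refl by blast
    qed
    have py: "p \<notin> N y" "q \<notin> N y"
      using no pq px N_sym by blast+
    have yT: "v = x \<or> v = y" if "v \<in> N y" "v \<notin> N u" for v
      using in_T[of v] that N_in_V c py by auto
    show False
    proof (rule confined[OF S, of "{x, y}" x])
      show "N k \<subseteq> {x, y} \<union> N u" if "k \<in> {x, y}" for k
        using that xT yT by blast
    qed (use V \<open>y \<in> N x\<close> refl in auto)
  qed
  \<comment> \<open>If \<open>x\<close> saw both, the degree bounds would leave it a single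
    neighbour \<open>a\<close> outside \<open>N c\<close>, and the first cop attacks from
    \<open>a\<close>.\<close>
  moreover have "\<not> (x \<in> N p \<and> x \<in> N q)"
  proof
    assume "x \<in> N p \<and> x \<in> N q"
    then have sub: "{x, p, q} \<subseteq> N x - N u"
      using N_sym refl nu by blast
    have card3: "card {x, p, q} = 3"
      using T(2) by auto
    then have eq: "N x - N u = {x, p, q}"
      using card_seteq[OF _ sub] deg_T[of x] V nu finite_N by auto
    have "N x \<inter> N u = N x - {x, p, q}"
      using eq nu by blast
    then have "card (N x \<inter> N u) \<le> 1"
      using card_Diff_subset[of "{x, p, q}" "N x"] card3 sub deg[OF V(4)] by auto
    moreover obtain a where a: "a \<in> N x" "a \<in> N u"
      using not_stuck[OF S_sym[OF S]] eq pq by blast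
    ultimately have "N x \<inter> N u = {a}"
      using finite_N by (auto simp: card_le_Suc0_iff_eq)
    then have "N x \<subseteq> insert x (insert a (N c))"
      using eq pq by blast
    then show False
      using one_free_neighbour[OF S _ a(2)] by blast
  qed
  ultimately show ?thesis
    using path[of p q] path[of q p] by blast
qed

text \<open>Besides the induced 5-cycle it records a position with the robber two steps from the
  second cop, which can then be carried around the cycle.\<close>

definition pentagon :: "'a \<Rightarrow> 'a \<Rightarrow> 'a \<Rightarrow> 'a \<Rightarrow> 'a \<Rightarrow> 'a \<Rightarrow> bool" where
  "pentagon u a b c d e \<longleftrightarrow> V - N u = {a, b, c, d, e} \<and> distinct [a, b, c, d, e] \<and>
     N a - N u = {e, a, b} \<and> N b - N u = {a, b, c} \<and> N c - N u = {b, c, d} \<and>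
     N d - N u = {c, d, e} \<and> N e - N u = {d, e, a} \<and> S u a c"

text \<open>As the territory is not a matching, some \<open>c\<close> has exactly two neighbours in
  it. The path through the rest closes a 5-cycle, which is induced by the bound
  \<open>deg_T\<close>.\<close>

lemma five_territory_pentagon:
  assumes deg: "\<And>v. v \<in> V \<Longrightarrow> card (N v) \<le> 4" and u: "u \<in> V" and card: "card (V - N u) = 5"
  shows "\<exists>a b c d e. pentagon u a b c d e"
proof -
  have deg_T: "card (N v - N u) \<le> 3" if "v \<in> V - N u" for v
    using no_vertex_of_degree_three_in_territory[OF deg u card that] .
  obtain c where c: "c \<in> V - N u" "\<not> card (N c - N u) \<le> 2"
    using territory_matching[OF u] by blast
  then have 3: "card (N c - N u) = 3"
    using deg_T[of c] by linarith
  have "c \<in> N c - N u"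
    using c N_refl by blast
  then have "card (N c - N u - {c}) = 2"
    using 3 by simp
  then obtain p q where "N c - N u - {c} = {p, q}" "p \<noteq> q"
    by (meson card_2_iff)
  then have pq: "N c - N u = {c, p, q}" "p \<noteq> q" "c \<noteq> p" "c \<noteq> q"
    using \<open>c \<in> N c - N u\<close> by blast+
  have "N c - N u \<subseteq> V - N u"
    using N_in_V by blast
  then have "card (V - N u - (N c - N u)) = 2"
    using card 3 card_Diff_subset[of "N c - N u" "V - N u"] finite_N by simp
  then obtain x' y' where xy': "V - N u - (N c - N u) = {x', y'}" "x' \<noteq> y'"
    by (meson card_2_iff)
  obtain x where S: "S u c x"
    using S_start u c by blast
  then have "x \<in> V - N u - (N c - N u)"
    using S_safe S_sym S_in_V by blast
  then obtain y where xy: "V - N u - (N c - N u) = {x, y}" "x \<noteq> y"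
    using xy' by (metis insert_commute insertE singletonD)
  have T: "V - N u = {c, p, q, x, y}"
    using xy(1) pq(1) \<open>N c - N u \<subseteq> V - N u\<close> by blast
  have dist: "distinct [c, p, q, x, y]"
    using xy pq by auto
  have pentagonI: ?thesis if pq': "N c - N u = {c, p', q'}" "distinct [c, p', q', x, y]" "V - N u = {c, p', q', x, y}"
      and adj: "x \<in> N p'" "y \<in> N x" "q' \<in> N y" for p' q'
  proof -
    have in_T: "c \<in> V - N u" "p' \<in> V - N u" "q' \<in> V - N u" "x \<in> V - N u" "y \<in> V - N u"
      using pq'(3) by blast+
    have three: "N v - N u = {v1, v, v2}"
      if "v \<in> V - N u" "v1 \<in> V - N u" "v2 \<in> V - N u" "v1 \<in> N v" "v2 \<in> N v" "card {v1, v, v2} = 3"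
      for v v1 v2
    proof (rule card_seteq[symmetric])
      show "{v1, v, v2} \<subseteq> N v - N u"
        using that N_refl by blast
      show "card (N v - N u) \<le> card {v1, v, v2}"
        using that deg_T by simp
    qed (simp add: finite_N)
    have "p' \<in> N c" "q' \<in> N c"
      using pq'(1) by blast+
    then have "c \<in> N p'" "c \<in> N q'" "p' \<in> N x" "x \<in> N y" "y \<in> N q'"
      using adj N_sym by blast+
    then have "N p' - N u = {c, p', x}" "N x - N u = {p', x, y}" "N y - N u = {x, y, q'}"
        "N q' - N u = {y, q', c}"
      using in_T adj pq'(2) by (intro three; auto)+
    then have "pentagon u c p' x y q'"
      using pq' S unfolding pentagon_def by auto
    then show ?thesis
      by blast
  qed
  show ?thesis
    using five_territory_path[OF deg u T dist pq(1) S deg_T]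
  proof
    assume "x \<in> N p \<and> y \<in> N x \<and> q \<in> N y"
    then show ?thesis
      using pentagonI[OF pq(1) dist T] by blast
  next
    assume "x \<in> N q \<and> y \<in> N x \<and> p \<in> N y"
    moreover have "N c - N u = {c, q, p}" "distinct [c, q, p, x, y]" "V - N u = {c, q, p, x, y}"
      using pq(1) dist T by auto
    ultimately show ?thesis
      using pentagonI by blast
  qed
qed

text \<open>When the second cop steps from \<open>a\<close> to \<open>b\<close>, the only safe
  answer in the territory is from \<open>c\<close> to \<open>d\<close>.\<close>

lemma pentagon_rotate:
  assumes "pentagon u a b c d e"
  shows "pentagon u b c d e a"
proof -
  have S: "S u a c" and N: "N a - N u = {e, a, b}" "N c - N u = {b, c, d}" "N b - N u = {a, b, c}"
    using assms unfolding pentagon_def by simp_all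
  then have b: "b \<in> N a"
    by blast
  have "u \<in> N u"
    using S S_in_V N_refl by blast
  then obtain v where v: "v \<in> N c" "S u b v" "v \<notin> N u" "v \<notin> N b"
    using escape[OF S _ b] by blast
  then have "v \<in> {b, c, d}" "v \<notin> {a, b, c}"
    unfolding N(2,3)[symmetric] by simp_all
  then have "S u b d"
    using v(2) by auto
  then show ?thesis
    using assms unfolding pentagon_def by auto
qed

text \<open>Otherwise the first cop moves to the outer neighbour \<open>w\<close> of
  \<open>c\<close>, which forces the robber to \<open>d\<close>, and then to \<open>c\<close>. With
  the second cop waiting on \<open>a\<close>, no vertex of \<open>N d\<close> is safe.\<close>

lemma pentagon_outer_neighbour:
  assumes pent: "pentagon u a b c d e" and deg: "card (N c) \<le> 4" and "N c \<inter> N u \<noteq> {}"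
  shows "N d \<inter> N u \<noteq> {}"
proof
  assume d: "N d \<inter> N u = {}"
  have S: "S u a c" and N: "N c - N u = {b, c, d}" "N d - N u = {c, d, e}" "N a - N u = {e, a, b}"
    and dist: "distinct [a, b, c, d, e]"
    using pent unfolding pentagon_def by simp_all
  obtain w where w: "w \<in> N c" "w \<in> N u"
    using assms(3) by blast
  have "N c \<inter> N u = N c - {b, c, d}"
    using N by blast
  moreover have "card {b, c, d} = 3" "{b, c, d} \<subseteq> N c"
    using dist N by auto
  ultimately have "card (N c \<inter> N u) \<le> 1"
    using card_Diff_subset[of "{b, c, d}" "N c"] deg by auto
  then have "N c \<inter> N u = {w}"
    using w finite_N by (auto simp: card_le_Suc0_iff_eq)
  then have Nc: "N c = {b, c, d, w}"
    using N by blast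
  have Nw: "w \<in> N w" "c \<in> N w"
    using w N_refl N_in_V N_sym by blast+
  have Na: "a \<in> N a" "b \<in> N a" "e \<in> N a"
    using N(3) by blast+
  have Nd: "N d = {c, d, e}"
    using N(2) d by blast
  obtain v where v: "v \<in> N c" "S w a v" "v \<notin> N w" "v \<notin> N a"
    using escape[OF S w(2) Na(1)] by blast
  then have "v = d"
    using Nc Nw Na by auto
  then obtain v' where "v' \<in> N d" "v' \<notin> N c" "v' \<notin> N a"
    using escape[OF v(2) Nw(2) Na(1)] by blast
  then show False
    using Nc Nd Na by auto
qed

text \<open>By connectivity some cycle vertex has a neighbour in \<open>N u\<close>; rotation
  spreads this around the cycle, giving each vertex a third neighbour.\<close>

lemma pentagon_degrees:
  assumes pent: "pentagon u a b c d e" and deg: "\<And>v. v \<in> V \<Longrightarrow> card (N v) \<le> 4" and u: "u \<in> V"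
    and v: "v \<in> V - N u"
  shows "card (N v) = 4"
proof -
  have rot: "pentagon u b c d e a" "pentagon u c d e a b" "pentagon u d e a b c" "pentagon u e a b c d"
    using pent by (metis pentagon_rotate)+
  have T: "V - N u = {a, b, c, d, e}"
    using pent unfolding pentagon_def by simp
  have deg': "card (N a) \<le> 4" "card (N b) \<le> 4" "card (N c) \<le> 4" "card (N d) \<le> 4" "card (N e) \<le> 4"
    using deg T by blast+
  let ?o = "\<lambda>v. N v \<inter> N u \<noteq> {}"
  have cyc: "?o c \<Longrightarrow> ?o d" "?o d \<Longrightarrow> ?o e" "?o e \<Longrightarrow> ?o a" "?o a \<Longrightarrow> ?o b" "?o b \<Longrightarrow> ?o c"
    using pentagon_outer_neighbour[OF pent deg'(3)] pentagon_outer_neighbour[OF rot(1) deg'(4)]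
      pentagon_outer_neighbour[OF rot(2) deg'(5)] pentagon_outer_neighbour[OF rot(3) deg'(1)]
      pentagon_outer_neighbour[OF rot(4) deg'(2)] by blast+
  have "\<exists>k\<in>V - N u. ?o k"
  proof (rule ccontr)
    assume "\<not> (\<exists>k\<in>V - N u. ?o k)"
    then have "N k \<subseteq> V - N u" if "k \<in> V - N u" for k
      using that N_in_V by blast
    then have "u \<in> V - N u"
      using connected[of v "V - N u" u] u v by blast
    then show False
      using N_refl u by blast
  qed
  then have "?o a \<or> ?o b \<or> ?o c \<or> ?o d \<or> ?o e"
    unfolding T by simp
  then have "?o a" "?o b" "?o c" "?o d" "?o e"
    using cyc by argo+
  moreover have v': "v = a \<or> v = b \<or> v = c \<or> v = d \<or> v = e"
    using v unfolding T by simp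
  ultimately have "?o v"
    by metis
  then have "card (N v \<inter> N u) \<noteq> 0"
    using finite_N by simp
  moreover have "card (N v - N u) = 3"
    using v' pent unfolding pentagon_def by auto
  moreover have "card (N v) = card (N v \<inter> N u) + card (N v - N u)"
    using card_Int_Diff[OF finite_N] by blast
  ultimately show ?thesis
    using deg[of v] v by simp
qed

section \<open>At least ten vertices\<close>

theorem card_V_ge_10: "card V \<ge> 10"
proof (rule ccontr)
  assume "\<not> card V \<ge> 10"
  then have le9: "card V \<le> 9"
    by simp
  have T: "5 \<le> card (V - N v)" if "v \<in> V" for v
    using small_territory[OF that _ le9] by (rule ccontr) simp
  have split: "card V = card (N v) + card (V - N v)" for v
    using card_Diff_subset[OF finite_N N_subset, of v] card_mono[OF finite_V N_subset, of v] by simp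
  have deg: "card (N v) \<le> 4" if "v \<in> V" for v
    using T[OF that] split[of v] le9 by linarith
  have far: "card (N v) = 4" if uv: "u \<in> V" "card (N u) = 4" "v \<in> V - N u" for u v
  proof -
    have "card (V - N u) = 5"
      using T[OF uv(1)] split[of u] le9 uv(2) by linarith
    then obtain a b c d e where "pentagon u a b c d e"
      using five_territory_pentagon[OF deg uv(1)] by blast
    then show ?thesis
      using pentagon_degrees deg uv by blast
  qed
  obtain u where u: "u \<in> V" "\<not> card (N u) \<le> 3"
    using not_max_degree_two by blast
  then have u4: "card (N u) = 4"
    using deg[of u] by linarith
  then have 9: "card V = 9"
    using T[OF u(1)] split[of u] le9 by linarith
  have all: "card (N w) = 4" if w: "w \<in> V" for w
  proof (rule ccontr)
    assume "card (N w) \<noteq> 4"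
    \<comment> \<open>If \<open>w\<close> were outside \<open>N v\<close>, then \<open>far\<close>
      would give it degree three.\<close>
    then have "v \<in> N w" if "v \<in> V" "card (N v) = 4" for v
      using far[of v w] that w N_sym by blast
    then have "insert u (V - N u) \<subseteq> N w"
      using far[OF u(1) u4] u u4 by blast
    then have "card (insert u (V - N u)) \<le> card (N w)"
      using finite_N card_mono by blast
    then show False
      using T[OF u(1)] deg[OF w] finite_V N_refl[OF u(1)] by simp
  qed
  \<comment> \<open>Counting ordered adjacent pairs in a cubic graph on nine vertices gives an odd
    number.\<close>
  let ?R = "SIGMA x:V. N x - {x}"
  have "card ?R = (\<Sum>x\<in>V. card (N x - {x}))"
    using finite_V finite_N by simp
  also have "\<dots> = (\<Sum>x\<in>V. 3)"
    using all N_refl by (intro sum.cong) auto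
  also have "\<dots> = 27"
    using 9 by simp
  finally have "card ?R = 27" .
  moreover have "even (card ?R)"
    using finite_V finite_N N_sym N_in_V
    by (intro even_card_sym_irrefl) (auto simp: sym_def irrefl_def)
  ultimately show False
    by simp
qed

end

section \<open>Positional analysis of the game\<close>

text \<open>Backward induction with the cops to move. Including \<open>win G n cs r\<close> makes it
  monotone, so that bounds for finitely many robber moves can be replaced by their maximum.\<close>

primrec win :: "('a, 'b) pre_digraph \<Rightarrow> nat \<Rightarrow> 'a list \<Rightarrow> 'a \<Rightarrow> bool" where
  "win G 0 cs r \<longleftrightarrow> r \<in> set cs"
| "win G (Suc n) cs r \<longleftrightarrow> win G n cs r \<or>
     (\<exists>cs'. list_all2 (token_move G) cs cs' \<and>
        (r \<in> set cs' \<or> (\<forall>r'. token_move G r r' \<longrightarrow> win G n cs' r')))"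

lemma win_mono: "win G n cs r \<Longrightarrow> n \<le> m \<Longrightarrow> win G m cs r"
  by (induction m) (auto simp: le_Suc_eq)

lemma win_swap: "win G n [c, d] r \<Longrightarrow> win G n [d, c] r"
proof (induction n arbitrary: c d r)
  case (Suc n)
  show ?case
  proof (cases "win G n [c, d] r")
    case True
    then show ?thesis
      using Suc.IH by simp
  next
    case False
    then obtain c' d' where "token_move G c c'" "token_move G d d'"
      "r \<in> {c', d'} \<or> (\<forall>r'. token_move G r r' \<longrightarrow> win G n [c', d'] r')"
      using Suc.prems by (auto simp: list_all2_Cons1)
    then have "list_all2 (token_move G) [d, c] [d', c']"
      "r \<in> set [d', c'] \<or> (\<forall>r'. token_move G r r' \<longrightarrow> win G n [d', c'] r')"
      using Suc.IH by auto
    then show ?thesis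
      unfolding win.simps by blast
  qed
qed auto

lemma token_moves_in_cop_placements:
  assumes "list_all2 (token_move G) cs cs'" "length cs = k"
  shows "cs' \<in> cop_placements G k"
  using assms unfolding cop_placements_def
  by (auto simp: list_all2_conv_all_nth in_set_conv_nth token_move_def)

section \<open>From won positions to a winning cop strategy\<close>

lemma play_legal:
  assumes "legal_cop_strategy G k \<sigma>" "legal_robber_strategy G k \<rho>"
  shows "play \<sigma> \<rho> n \<in> histories G k \<and> \<sigma> (play \<sigma> \<rho> n) \<in> cop_placements G k"
proof (induction n)
  case 0
  then show ?case
    using assms(1) by (simp add: histories_def legal_cop_strategy_def)
next
  case (Suc n)
  let ?h = "play \<sigma> \<rho> n"
  have "\<rho> ?h (\<sigma> ?h) \<in> verts G"
    using Suc assms(2) unfolding legal_robber_strategy_def token_move_def by (cases "?h = []") auto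
  then have h: "play \<sigma> \<rho> (Suc n) \<in> histories G k"
    using Suc by (simp add: histories_def Let_def)
  then have "list_all2 (token_move G) (fst (last (play \<sigma> \<rho> (Suc n)))) (\<sigma> (play \<sigma> \<rho> (Suc n)))"
    using assms(1) unfolding legal_cop_strategy_def by (auto simp: Let_def)
  moreover have "length (fst (last (play \<sigma> \<rho> (Suc n)))) = k"
    using Suc by (simp add: Let_def cop_placements_def)
  ultimately show ?case
    using h token_moves_in_cop_placements by blast
qed

lemma cops_win_if_win:
  assumes c0: "c0 \<in> cop_placements G k" and start: "\<And>r. r \<in> verts G \<Longrightarrow> \<exists>n. win G n c0 r"
  shows "cops_win G k"
proof -
  \<comment> \<open>Following the least \<open>n\<close> makes sure that the cops make progress.\<close>
  define good where "good cs r cs' \<longleftrightarrow> list_all2 (token_move G) cs cs' \<and>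
      (r \<in> set cs' \<or> (\<forall>r'. token_move G r r' \<longrightarrow> win G ((LEAST n. win G n cs r) - 1) cs' r'))"
    for cs r cs'
  \<comment> \<open>Standing still is the fallback that keeps the strategy legal when no good move
    exists.\<close>
  define \<sigma> where "\<sigma> h = (if h = [] then c0
      else if \<exists>cs'. good (fst (last h)) (snd (last h)) cs'
        then SOME cs'. good (fst (last h)) (snd (last h)) cs' else fst (last h))" for h
  have \<sigma>_good: "good (fst (last h)) (snd (last h)) (\<sigma> h)"
    if "h \<noteq> []" "\<exists>cs'. good (fst (last h)) (snd (last h)) cs'" for h
    using that someI_ex[OF that(2)] by (simp add: \<sigma>_def)
  have "list_all2 (token_move G) (fst (last h)) (\<sigma> h)" if h: "h \<in> histories G k" "h \<noteq> []" for h
  proof (cases "\<exists>cs'. good (fst (last h)) (snd (last h)) cs'")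
    case True
    then show ?thesis
      using \<sigma>_good[OF h(2)] by (simp add: good_def)
  next
    case False
    have "last h \<in> cop_placements G k \<times> verts G"
      using h last_in_set[of h] by (auto simp: histories_def)
    then show ?thesis
      using False h by (auto simp: \<sigma>_def cop_placements_def token_move_def list_all2_conv_all_nth)
  qed
  then have \<sigma>: "legal_cop_strategy G k \<sigma>"
    using c0 by (simp add: legal_cop_strategy_def \<sigma>_def)
  have "captures \<sigma> \<rho>" if \<rho>: "legal_robber_strategy G k \<rho>" for \<rho>
  proof -
    have progress: "captures \<sigma> \<rho>"
      if "win G n (fst (last (play \<sigma> \<rho> (Suc i)))) (snd (last (play \<sigma> \<rho> (Suc i))))" for n i
      using that
    proof (induction n arbitrary: i rule: less_induct)
      case (less n)
      define h where "h = play \<sigma> \<rho> (Suc i)"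
      define cs where "cs = fst (last h)"
      define r where "r = snd (last h)"
      have win_n: "win G n cs r"
        using less.prems by (simp add: cs_def r_def h_def)
      define m where "m = (LEAST n. win G n cs r)"
      have win_m: "win G m cs r" and le: "m \<le> n"
        unfolding m_def using win_n by (rule LeastI, rule Least_le)
      have h: "h \<noteq> []" "h \<in> histories G k" "\<sigma> h \<in> cop_placements G k"
        using play_legal[OF \<sigma> \<rho>, of "Suc i"] unfolding h_def by (auto simp: Let_def)
      show ?case
      proof (cases m)
        case 0
        then have "\<rho> (play \<sigma> \<rho> i) (\<sigma> (play \<sigma> \<rho> i)) \<in> set (\<sigma> (play \<sigma> \<rho> i))"
          using win_m by (simp add: cs_def r_def h_def Let_def)
        then show ?thesis
          unfolding captures_def by (metis (no_types, lifting))
      next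
        case (Suc m')
        \<comment> \<open>By minimality the first disjunct of \<open>win\<close> fails at
          \<open>Suc m'\<close>, so a good move must exist.\<close>
        then have "\<not> win G m' cs r"
          unfolding m_def by (metis lessI not_less_Least)
        then have "\<exists>cs'. good cs r cs'"
          using win_m Suc unfolding good_def m_def[symmetric] by simp
        then have good: "good cs r (\<sigma> h)"
          using \<sigma>_good[OF h(1)] by (simp add: cs_def r_def)
        show ?thesis
        proof (cases "r \<in> set (\<sigma> h)")
          case True
          then show ?thesis
            using h(1) unfolding captures_def r_def h_def by (metis (no_types, lifting))
        next
          case False
          have "token_move G r (\<rho> h (\<sigma> h))"
            using \<rho> h unfolding legal_robber_strategy_def r_def by blast
          then have "win G m' (\<sigma> h) (\<rho> h (\<sigma> h))"
            using good False Suc unfolding good_def m_def[symmetric] by simp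
          moreover have "last (play \<sigma> \<rho> (Suc (Suc i))) = (\<sigma> h, \<rho> h (\<sigma> h))"
            unfolding h_def by (simp add: Let_def)
          ultimately show ?thesis
            using less.IH[of m' "Suc i"] Suc le by simp
        qed
      qed
    qed
    have "\<sigma> [] = c0"
      by (simp add: \<sigma>_def)
    moreover have "\<rho> [] c0 \<in> verts G"
      using \<rho> c0 unfolding legal_robber_strategy_def by blast
    moreover from this obtain n where "win G n c0 (\<rho> [] c0)"
      using start by blast
    ultimately show ?thesis
      using progress[of n 0] by (simp add: Let_def)
  qed
  then show ?thesis
    unfolding cops_win_def using \<sigma> by blast
qed

text \<open>Safe positions are those not won in any number of rounds. If every robber answer lost,
  finiteness would give a common bound and the present position would be won too.\<close>

lemma evasion_if_not_cops_win:
  assumes "graph G" "Digraph_Component.connected G" "\<not> cops_win G 2"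
  shows "evasion (verts G) (\<lambda>x. {y. token_move G x y})
    (\<lambda>c d r. {c, d, r} \<subseteq> verts G \<and> (\<forall>n. \<not> win G n [c, d] r))"
proof -
  interpret graph G
    by fact
  have sc: "strongly_connected G"
    using assms(2) sym_arcs symmetric_connected_imp_strongly_connected by blast
  show ?thesis
  proof
    show "finite (verts G)"
      by simp
    show "verts G \<noteq> {}"
      using sc by (simp add: strongly_connected_def)
    show "{y. token_move G x y} \<subseteq> verts G" for x
      by (auto simp: token_move_def)
    show "x \<in> {y. token_move G x y}" if "x \<in> verts G" for x
      using that by (simp add: token_move_def)
    show "x \<in> {x. token_move G y x}" if "y \<in> {y. token_move G x y}" for x y
      using that sym_arcs by (auto simp: token_move_def arcs_ends_symmetric)
    show "y \<in> X" if x: "x \<in> X" "x \<in> verts G" "y \<in> verts G"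
      and X: "\<And>z. z \<in> X \<Longrightarrow> {y. token_move G z y} \<subseteq> X" for x y X
    proof -
      have "x \<rightarrow>\<^sup>*\<^bsub>G\<^esub> y"
        using sc x by (simp add: strongly_connected_def)
      then show ?thesis
      proof (induction rule: reachable_induct)
        case base
        then show ?case
          using x by simp
      next
        case (step y z)
        then have "token_move G y z"
          by (auto simp: token_move_def adj_in_verts)
        then show ?case
          using X[OF step(3)] by blast
      qed
    qed
    fix c d r
    show "\<exists>r. {c, d, r} \<subseteq> verts G \<and> (\<forall>n. \<not> win G n [c, d] r)" if "c \<in> verts G" "d \<in> verts G"
      using cops_win_if_win[of "[c, d]" G 2] assms(3) that by (auto simp: cop_placements_def)
    assume S: "{c, d, r} \<subseteq> verts G \<and> (\<forall>n. \<not> win G n [c, d] r)"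
    then show "c \<in> verts G \<and> d \<in> verts G \<and> r \<in> verts G"
      by simp
    show "{d, c, r} \<subseteq> verts G \<and> (\<forall>n. \<not> win G n [d, c] r)"
      using S win_swap by (metis insert_commute)
    show "r \<notin> {y. token_move G c y}"
    proof
      assume "r \<in> {y. token_move G c y}"
      then have "list_all2 (token_move G) [c, d] [r, d]"
        using S by (simp add: token_move_def)
      moreover have "r \<in> set [r, d]"
        by simp
      ultimately have "win G (Suc 0) [c, d] r"
        unfolding win.simps by blast
      then show False
        using S by blast
    qed
    show "\<exists>r'\<in>{y. token_move G r y}. {c', d', r'} \<subseteq> verts G \<and> (\<forall>n. \<not> win G n [c', d'] r')"
      if cd: "c' \<in> {y. token_move G c y}" "d' \<in> {y. token_move G d y}" for c' d'
    proof (rule ccontr)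
      assume "\<not> ?thesis"
      then have "\<forall>r'\<in>{y. token_move G r y}. \<exists>n. win G n [c', d'] r'"
        using cd by (auto simp: token_move_def)
      then obtain f where f: "\<And>r'. token_move G r r' \<Longrightarrow> win G (f r') [c', d'] r'"
        by (metis mem_Collect_eq)
      have fin: "finite {y. token_move G r y}"
        by (rule finite_subset[of _ "verts G"]) (auto simp: token_move_def)
      have "win G (Max (f ` {y. token_move G r y})) [c', d'] r'" if "token_move G r r'" for r'
        using f[OF that] by (rule win_mono) (use fin that in \<open>auto intro: Max_ge\<close>)
      moreover have "list_all2 (token_move G) [c, d] [c', d']"
        using cd by simp
      ultimately have "win G (Suc (Max (f ` {y. token_move G r y}))) [c, d] r"
        unfolding win.simps by blast
      then show False
        using S by blast
    qed
  qed
qed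

theorem theorem1:
  fixes G :: "('a, 'b) pre_digraph"
  assumes "graph G"
    and "Digraph_Component.connected G"
    and "card (verts G) \<le> 9"
  shows "cop_number G \<le> 2"
proof -
  have "cops_win G 2"
  proof (rule ccontr)
    assume "\<not> cops_win G 2"
    then have "10 \<le> card (verts G)"
      using evasion.card_V_ge_10[OF evasion_if_not_cops_win] assms by blast
    then show False
      using assms(3) by simp
  qed
  then show ?thesis
    unfolding cop_number_def by (rule Least_le)
qed

end
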